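(* For every integer $n\ge 1$ and every tree $T_n$ on $n$ vertices, $R_g(T_n)\le n^{d+1}$, where $d=d(T_n)$ denotes the diameter of $T_n$.
   Context: All graphs are finite and simple. The diameter of a tree is the length (number of edges) of a longest path in it. A finite set $P$ of points in the plane is in general position if no three of its points are collinear. $K_P$ denotes the complete geometric graph on $P$: its vertices are the points of $P$ and its edges are all straight line segments between two points of $P$. A subgraph of $K_P$ is non-crossing if no two of its edges cross each other. For an outerplanar graph $G$ (in particular for a tree), $R_g(G)$ is the minimum integer $N$ such that for every set $P$ of $N$ points in the plane in general position and every colouring of the edges of $K_P$ with two colours, there is a monochromatic non-crossing subgraph of $K_P$ isomorphic to $G$. *)

theory Defs
  imports "HOL-Analysis.Analysis" "HOL-Library.Extended_Nat"
begin

section \<open>Finite simple graphs\<close>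

record 'a sgraph =
  verts :: "'a set"
  edges :: "'a set set"

definition simple_graph :: "'a sgraph \<Rightarrow> bool" where
  "simple_graph G \<longleftrightarrow> finite (verts G) \<and>
     (\<forall>e\<in>edges G. \<exists>u\<in>verts G. \<exists>v\<in>verts G. u \<noteq> v \<and> e = {u, v})"

definition subgraph :: "'a sgraph \<Rightarrow> 'a sgraph \<Rightarrow> bool" where
  "subgraph H G \<longleftrightarrow> simple_graph H \<and> verts H \<subseteq> verts G \<and> edges H \<subseteq> edges G"

definition isomorphic :: "'a sgraph \<Rightarrow> 'b sgraph \<Rightarrow> bool" where
  "isomorphic G H \<longleftrightarrow> (\<exists>f. bij_betw f (verts G) (verts H) \<and>
     (\<forall>u\<in>verts G. \<forall>v\<in>verts G. {u, v} \<in> edges G \<longleftrightarrow> {f u, f v} \<in> edges H))"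

text \<open>A path is given by its list of (pairwise distinct) vertices, so its length,
  counted in edges, is the length of the list minus one.\<close>

definition graph_path :: "'a sgraph \<Rightarrow> 'a list \<Rightarrow> bool" where
  "graph_path G xs \<longleftrightarrow> xs \<noteq> [] \<and> distinct xs \<and> set xs \<subseteq> verts G \<and>
     (\<forall>i. Suc i < length xs \<longrightarrow> {xs ! i, xs ! Suc i} \<in> edges G)"

definition connected_graph :: "'a sgraph \<Rightarrow> bool" where
  "connected_graph G \<longleftrightarrow> verts G \<noteq> {} \<and>
     (\<forall>u\<in>verts G. \<forall>v\<in>verts G. \<exists>xs. graph_path G xs \<and> hd xs = u \<and> last xs = v)"

definition graph_cycle :: "'a sgraph \<Rightarrow> 'a list \<Rightarrow> bool" where
  "graph_cycle G xs \<longleftrightarrow> length xs \<ge> 3 \<and> graph_path G xs \<and> {last xs, hd xs} \<in> edges G"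

definition is_tree :: "'a sgraph \<Rightarrow> bool" where
  "is_tree G \<longleftrightarrow> simple_graph G \<and> connected_graph G \<and> (\<nexists>xs. graph_cycle G xs)"

definition tree_diameter :: "'a sgraph \<Rightarrow> nat" where
  "tree_diameter G = Max {length xs - 1 | xs. graph_path G xs}"

section \<open>Complete geometric graphs\<close>

definition general_position :: "(real^2) set \<Rightarrow> bool" where
  "general_position P \<longleftrightarrow> finite P \<and>
     (\<forall>a\<in>P. \<forall>b\<in>P. \<forall>c\<in>P. a \<noteq> b \<and> a \<noteq> c \<and> b \<noteq> c \<longrightarrow> \<not> collinear {a, b, c})"

text \<open>An edge, i.e. a straight line segment between two points of \<open>P\<close>, is represented
  by the set of its two end points.\<close>

definition complete_geometric_graph :: "(real^2) set \<Rightarrow> (real^2) sgraph" where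
  "complete_geometric_graph P =
     \<lparr>verts = P, edges = {{p, q} | p q. p \<in> P \<and> q \<in> P \<and> p \<noteq> q}\<rparr>"

text \<open>Two different segments cross if they have a common interior point. When the end
  points are in general position, segments sharing an end point do not cross, and no end point
  of one segment lies in the interior of another.\<close>

definition edges_cross :: "(real^2) set \<Rightarrow> (real^2) set \<Rightarrow> bool" where
  "edges_cross e f \<longleftrightarrow> e \<noteq> f \<and>
     (\<exists>a b c d. e = {a, b} \<and> f = {c, d} \<and> open_segment a b \<inter> open_segment c d \<noteq> {})"

definition non_crossing :: "(real^2) sgraph \<Rightarrow> bool" where
  "non_crossing H \<longleftrightarrow> (\<forall>e\<in>edges H. \<forall>f\<in>edges H. \<not> edges_cross e f)"

definition monochromatic :: "('a set \<Rightarrow> bool) \<Rightarrow> 'a sgraph \<Rightarrow> bool" where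
  "monochromatic col H \<longleftrightarrow> (\<exists>c. \<forall>e\<in>edges H. col e = c)"

section \<open>The geometric Ramsey number\<close>

text \<open>The two colours are the truth values; only the values of a colouring on the edges of
  the complete geometric graph matter.\<close>

definition geometric_ramsey_prop :: "'a sgraph \<Rightarrow> nat \<Rightarrow> bool" where
  "geometric_ramsey_prop G N \<longleftrightarrow>
     (\<forall>P. general_position P \<and> card P = N \<longrightarrow>
       (\<forall>col. \<exists>H. subgraph H (complete_geometric_graph P) \<and> monochromatic col H \<and>
          non_crossing H \<and> isomorphic G H))"

text \<open>The minimum is taken in \<open>enat\<close>, where it is \<open>\<infinity>\<close> if no such \<open>N\<close> exists. Thus a finite
  upper bound includes the assertion that some such \<open>N\<close> exists.\<close>

definition geometric_ramsey :: "'a sgraph \<Rightarrow> enat" where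
  "geometric_ramsey G = Inf {enat N | N. geometric_ramsey_prop G N}"

end

theory Submission
  imports Defs
begin

text \<open>Fix a direction \<open>u\<close> in which no two points of \<open>P\<close> have the same coordinate, so that the points are
ordered from left to right, and call the colours red and blue. The idea is to look for red rooted
trees whose root is the leftmost vertex and for blue rooted trees whose root is the rightmost
vertex.

Let \<open>T1\<close> and \<open>T2\<close> be rooted trees, and let \<open>f(T1, T2)\<close> be the least number of points in general
position that forces a red non-crossing \<open>T1\<close> rooted at its leftmost point or a blue non-crossing \<open>T2\<close>
rooted at its rightmost point. Suppose that some point \<open>p\<close> has at least \<open>A = (\<Sum>B. f(B, T2))\<close> red
neighbours to its right, where \<open>B\<close> runs over the branches of \<open>T1\<close> at its root. Cut these neighbours
by angle around \<open>p\<close> into consecutive blocks of sizes \<open>f(B, T2)\<close>. Each block contains a blue \<open>T2\<close>, and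
then nothing is left to show, or a red copy of its branch whose root is leftmost. In the latter case
\<open>p\<close> together with these copies is a red \<open>T1\<close>: the copies lie in disjoint wedges at \<open>p\<close>, and \<open>p\<close> sees
the root of each copy because the rest of the copy lies to the right of that root (lemma
\<open>join_branches\<close>). By symmetry, a point with at least \<open>A' = (\<Sum>B. f(T1, B))\<close> blue neighbours to its
left, with the sum over the branches of \<open>T2\<close>, yields a blue \<open>T2\<close> or a red \<open>T1\<close>.

If no such points exist, then counting each red edge at its left end and each blue edge at its right
end gives \<open>N (N - 1) / 2 \<le> N (A + A' - 2)\<close>. Hence \<open>f(T1, T2) \<le> 2 (A + A') - 2\<close> (lemma
\<open>ex_large_degree\<close>). As the sizes of the branches add up to less than the size of the tree, this
recursion gives \<open>f(T1, T2) \<le> n1 n2 4\<^bsup>h1+h2-2\<^esup>\<close> for trees with \<open>n1\<close> and \<open>n2\<close> vertices and depths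
at most \<open>h1, h2 \<ge> 1\<close> (lemma \<open>red_or_blue_drawing\<close>).

Finally, take \<open>T1 = T2 = T\<close>, rooted at a centre, so that the depth is at most \<open>h = \<lceil>d/2\<rceil>\<close>. If
\<open>h \<ge> 2\<close>, a path of length \<open>d\<close> has at least four vertices, so that
\<open>n\<^sup>2 4\<^bsup>2h-2\<^esup> \<le> n\<^bsup>2h\<^esup> \<le> n\<^bsup>d+1\<^esup>\<close>; smaller \<open>h\<close> are immediate.\<close>

section \<open>Branches and centres of trees\<close>

lemma graph_path_iff_successively:
  "graph_path G xs \<longleftrightarrow> xs \<noteq> [] \<and> distinct xs \<and> set xs \<subseteq> verts G \<and>
     successively (\<lambda>x y. {x, y} \<in> edges G) xs"
  by (simp add: graph_path_def successively_conv_nth Suc_lessI)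

lemma rtranclp_imp_distinct_list:
  assumes "R\<^sup>*\<^sup>* a b"
  shows "\<exists>xs. xs \<noteq> [] \<and> hd xs = a \<and> last xs = b \<and> distinct xs \<and> successively R xs"
  using assms
proof (induction rule: rtranclp_induct)
  case base
  show ?case by (rule exI[of _ "[a]"]) simp
next
  case (step y z)
  then obtain xs where xs: "xs \<noteq> []" "hd xs = a" "last xs = y" "distinct xs" "successively R xs"
    by blast
  show ?case
  proof (cases "z \<in> set xs")
    case False
    with xs step.hyps show ?thesis
      by (intro exI[of _ "xs @ [z]"]) (auto simp: successively_append_iff)
  next
    case True
    then obtain ys zs where "xs = ys @ z # zs" by (meson split_list)
    with xs show ?thesis
      by (intro exI[of _ "ys @ [z]"]) (auto simp: successively_append_iff hd_append)
  qed
qed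

lemma successively_imp_rtranclp:
  assumes "successively R xs" "x \<in> set xs"
  shows "R\<^sup>*\<^sup>* (hd xs) x"
  using assms
proof (induction xs rule: induct_list012)
  case (3 a b xs)
  then show ?case
    by (auto intro: converse_rtranclp_into_rtranclp)
qed auto

text \<open>A tree is taken apart at a root \<open>r\<close>. The branch at a child \<open>c\<close> is the component of \<open>c\<close> after
the removal of \<open>r\<close>. As reachability in the graph without \<open>r\<close> is symmetric and transitive, most
properties of branches need no explicit paths.\<close>

definition adjacent_off :: "'a sgraph \<Rightarrow> 'a \<Rightarrow> 'a \<Rightarrow> 'a \<Rightarrow> bool" where
  "adjacent_off T r x y \<longleftrightarrow> {x, y} \<in> edges T \<and> x \<noteq> r \<and> y \<noteq> r"

definition branch :: "'a sgraph \<Rightarrow> 'a \<Rightarrow> 'a \<Rightarrow> 'a sgraph" where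
  "branch T r c =
     \<lparr>verts = {x. (adjacent_off T r)\<^sup>*\<^sup>* c x},
      edges = {e \<in> edges T. e \<subseteq> {x. (adjacent_off T r)\<^sup>*\<^sup>* c x}}\<rparr>"

definition children :: "'a sgraph \<Rightarrow> 'a \<Rightarrow> 'a set" where
  "children T r = {c. {r, c} \<in> edges T}"

text \<open>The bound \<open>h\<close> counts edges, whereas the length of the list counts vertices.\<close>

definition depth_le :: "'a sgraph \<Rightarrow> 'a \<Rightarrow> nat \<Rightarrow> bool" where
  "depth_le T r h \<longleftrightarrow> (\<forall>xs. graph_path T xs \<and> hd xs = r \<longrightarrow> length xs \<le> Suc h)"

lemma simple_graph_edgeD:
  assumes "simple_graph G" "{x, y} \<in> edges G"
  shows "x \<in> verts G" "y \<in> verts G" "x \<noteq> y"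
  using assms by (auto simp: simple_graph_def doubleton_eq_iff)

lemma adjacent_off_sym:
  "(adjacent_off T r)\<^sup>*\<^sup>* x y \<Longrightarrow> (adjacent_off T r)\<^sup>*\<^sup>* y x"
  by (rule sympD[OF symp_rtranclp]) (auto simp: symp_def adjacent_off_def insert_commute)

lemma root_notin_branch:
  assumes "simple_graph T" "c \<in> children T r"
  shows "r \<notin> verts (branch T r c)"
proof -
  have "c \<noteq> r"
    using simple_graph_edgeD(3)[OF assms(1), of r c] assms(2) by (auto simp: children_def)
  moreover have "(adjacent_off T r)\<^sup>*\<^sup>* c x \<Longrightarrow> c \<noteq> r \<Longrightarrow> x \<noteq> r" for x
    by (induction rule: rtranclp_induct) (auto simp: adjacent_off_def)
  ultimately show ?thesis by (auto simp: branch_def)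
qed

lemma child_in_branch: "c \<in> verts (branch T r c)"
  by (simp add: branch_def)

lemma branch_subset:
  assumes "simple_graph T" "c \<in> children T r"
  shows "verts (branch T r c) \<subseteq> verts T" "edges (branch T r c) \<subseteq> edges T"
proof -
  have "c \<in> verts T"
    using simple_graph_edgeD(2)[OF assms(1), of r c] assms(2) by (simp add: children_def)
  moreover have "(adjacent_off T r)\<^sup>*\<^sup>* c x \<Longrightarrow> c \<in> verts T \<Longrightarrow> x \<in> verts T" for x
    by (induction rule: rtranclp_induct)
      (auto simp: adjacent_off_def dest: simple_graph_edgeD(2)[OF assms(1)])
  ultimately show "verts (branch T r c) \<subseteq> verts T" by (auto simp: branch_def)
qed (auto simp: branch_def)

lemma path_stays_in_branch:
  assumes "graph_path T (r # c # zs)"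
  shows "c \<in> children T r" "set (c # zs) \<subseteq> verts (branch T r c)"
proof -
  have p: "distinct (r # c # zs)" "successively (\<lambda>x y. {x, y} \<in> edges T) (r # c # zs)"
    using assms by (auto simp only: graph_path_iff_successively)
  then show "c \<in> children T r" by (simp add: children_def)
  have "successively (adjacent_off T r) (c # zs)"
    by (rule successively_mono[where P = "\<lambda>x y. {x, y} \<in> edges T"])
      (use p in \<open>auto simp: adjacent_off_def\<close>)
  from successively_imp_rtranclp[OF this] show "set (c # zs) \<subseteq> verts (branch T r c)"
    by (auto simp: branch_def)
qed

text \<open>Every vertex that is reachable without visiting \<open>r\<close> lies in the branch, so a connecting path can
be found inside the branch. This gives the connectedness of a branch, and, for \<open>x\<close> and \<open>y\<close> both
adjacent to \<open>r\<close>, a path that \<open>r\<close> would close to a cycle.\<close>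

lemma path_off_root:
  assumes "simple_graph T" "c \<in> children T r" "(adjacent_off T r)\<^sup>*\<^sup>* c x"
    and "(adjacent_off T r)\<^sup>*\<^sup>* x y"
  shows "\<exists>xs. graph_path (branch T r c) xs \<and> hd xs = x \<and> last xs = y"
proof -
  obtain xs where xs: "xs \<noteq> []" "hd xs = x" "last xs = y" "distinct xs"
      "successively (adjacent_off T r) xs"
    using rtranclp_imp_distinct_list[OF assms(4)] by blast
  have in_branch: "z \<in> set xs \<Longrightarrow> (adjacent_off T r)\<^sup>*\<^sup>* c z" for z
    using successively_imp_rtranclp[OF xs(5)] xs(2) assms(3) by (meson rtranclp_trans)
  have "successively (\<lambda>x y. {x, y} \<in> edges (branch T r c)) xs"
    by (rule successively_mono[OF xs(5)]) (auto simp: branch_def adjacent_off_def in_branch)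
  with xs in_branch show ?thesis
    by (intro exI[of _ xs]) (auto simp: graph_path_iff_successively branch_def)
qed

lemma graph_path_mono:
  assumes "graph_path G xs" "verts G \<subseteq> verts H" "edges G \<subseteq> edges H"
  shows "graph_path H xs"
  using assms unfolding graph_path_def by blast

lemma graph_path_Cons:
  assumes "graph_path G xs" "r \<in> verts G" "r \<notin> set xs" "{r, hd xs} \<in> edges G"
  shows "graph_path G (r # xs)"
  using assms by (cases xs) (auto simp: graph_path_iff_successively)

text \<open>This is where acyclicity is used: a common vertex of two branches would give a path between the
two children that avoids \<open>r\<close>, hence a cycle through \<open>r\<close>.\<close>

lemma branches_disjoint:
  assumes "is_tree T" "c \<in> children T r" "c' \<in> children T r" "c \<noteq> c'"
  shows "verts (branch T r c) \<inter> verts (branch T r c') = {}"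
proof (rule ccontr)
  have simple: "simple_graph T" using assms(1) by (simp add: is_tree_def)
  assume "\<not> ?thesis"
  then obtain x where "(adjacent_off T r)\<^sup>*\<^sup>* c x" "(adjacent_off T r)\<^sup>*\<^sup>* c' x"
    by (auto simp: branch_def)
  then have "(adjacent_off T r)\<^sup>*\<^sup>* c c'"
    by (meson adjacent_off_sym rtranclp_trans)
  with path_off_root[OF simple assms(2)] obtain xs
    where xs: "graph_path (branch T r c) xs" "hd xs = c" "last xs = c'"
    by blast
  have "r \<notin> set xs"
    using xs(1) root_notin_branch[OF simple assms(2)] by (auto simp: graph_path_def)
  moreover have xsT: "graph_path T xs"
    using graph_path_mono[OF xs(1)] branch_subset[OF simple assms(2)] by blast
  moreover have r: "{r, c} \<in> edges T" "{r, c'} \<in> edges T"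
    using assms by (auto simp: children_def)
  moreover have "r \<in> verts T" using simple_graph_edgeD(1)[OF simple r(1)] .
  ultimately have "graph_path T (r # xs)"
    using graph_path_Cons xs(2) by metis
  moreover have "length (r # xs) \<ge> 3"
  proof -
    obtain a ys where "xs = a # ys" using xs(1) by (cases xs) (auto simp: graph_path_def)
    then show ?thesis using xs(2,3) assms(4) by (cases ys) auto
  qed
  moreover have "{last (r # xs), hd (r # xs)} \<in> edges T"
    using r(2) xs(1,3) by (auto simp: graph_path_def insert_commute)
  ultimately have "graph_cycle T (r # xs)" by (simp add: graph_cycle_def)
  with assms(1) show False by (auto simp: is_tree_def)
qed

lemma verts_eq_branches:
  assumes "is_tree T" "r \<in> verts T"
  shows "verts T = insert r (\<Union>c\<in>children T r. verts (branch T r c))"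
proof
  have simple: "simple_graph T" using assms(1) by (simp add: is_tree_def)
  show "insert r (\<Union>c\<in>children T r. verts (branch T r c)) \<subseteq> verts T"
    using branch_subset(1)[OF simple] assms(2) by blast
  show "verts T \<subseteq> insert r (\<Union>c\<in>children T r. verts (branch T r c))"
  proof
    fix x assume "x \<in> verts T"
    then obtain xs where xs: "graph_path T xs" "hd xs = r" "last xs = x"
      using assms unfolding is_tree_def connected_graph_def by blast
    then obtain ys where ys: "xs = r # ys" by (cases xs) (auto simp: graph_path_def)
    show "x \<in> insert r (\<Union>c\<in>children T r. verts (branch T r c))"
    proof (cases ys)
      case (Cons c zs)
      have "x \<in> set (c # zs)" using xs(3) ys Cons by auto
      then show ?thesis
        using path_stays_in_branch[of T r c zs] xs(1) ys Cons by blast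
    qed (use xs ys in auto)
  qed
qed

lemma edges_eq_branches:
  assumes "is_tree T" "r \<in> verts T"
  shows "edges T = (\<Union>c\<in>children T r. insert {r, c} (edges (branch T r c)))"
proof
  have simple: "simple_graph T" using assms(1) by (simp add: is_tree_def)
  show "(\<Union>c\<in>children T r. insert {r, c} (edges (branch T r c))) \<subseteq> edges T"
    using branch_subset(2)[OF simple] by (auto simp: children_def)
  show "edges T \<subseteq> (\<Union>c\<in>children T r. insert {r, c} (edges (branch T r c)))"
  proof
    fix e assume e: "e \<in> edges T"
    then obtain x y where xy: "e = {x, y}" "x \<in> verts T" "y \<in> verts T"
      using simple by (auto simp: simple_graph_def)
    show "e \<in> (\<Union>c\<in>children T r. insert {r, c} (edges (branch T r c)))"
    proof (cases "r \<in> e")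
      case True
      then show ?thesis using e xy by (auto simp: children_def insert_commute)
    next
      case False
      have "x \<in> insert r (\<Union>c\<in>children T r. verts (branch T r c))"
        using xy(2) by (simp flip: verts_eq_branches[OF assms])
      with False xy(1) obtain c where c: "c \<in> children T r" "x \<in> verts (branch T r c)"
        by blast
      moreover have "adjacent_off T r x y"
        using False e xy by (auto simp: adjacent_off_def)
      ultimately have "e \<in> edges (branch T r c)"
        using e xy by (auto simp: branch_def)
      with c(1) show ?thesis by blast
    qed
  qed
qed

lemma is_tree_branch:
  assumes "is_tree T" "c \<in> children T r"
  shows "is_tree (branch T r c)"
  unfolding is_tree_def
proof (intro conjI)
  have simple: "simple_graph T" using assms(1) by (simp add: is_tree_def)
  note sub = branch_subset[OF simple assms(2)]
  have fin: "finite (verts (branch T r c))"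
    using sub(1) simple by (auto simp: simple_graph_def intro: finite_subset)
  moreover have "\<exists>u\<in>verts (branch T r c). \<exists>v\<in>verts (branch T r c). u \<noteq> v \<and> e = {u, v}"
    if "e \<in> edges (branch T r c)" for e
  proof -
    have e: "e \<in> edges T" "e \<subseteq> verts (branch T r c)" using that by (auto simp: branch_def)
    then obtain u v where "u \<noteq> v" "e = {u, v}"
      using simple unfolding simple_graph_def by blast
    with e(2) show ?thesis by blast
  qed
  ultimately show "simple_graph (branch T r c)" by (simp add: simple_graph_def)
  show "connected_graph (branch T r c)"
    unfolding connected_graph_def
  proof (intro conjI ballI)
    show "verts (branch T r c) \<noteq> {}" using child_in_branch by fast
    fix x y assume "x \<in> verts (branch T r c)" "y \<in> verts (branch T r c)"
    then have *: "(adjacent_off T r)\<^sup>*\<^sup>* c x" "(adjacent_off T r)\<^sup>*\<^sup>* c y"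
      by (auto simp: branch_def)
    then have "(adjacent_off T r)\<^sup>*\<^sup>* x y"
      by (meson adjacent_off_sym rtranclp_trans)
    with path_off_root[OF simple assms(2) *(1)]
    show "\<exists>xs. graph_path (branch T r c) xs \<and> hd xs = x \<and> last xs = y" by blast
  qed
  show "\<nexists>xs. graph_cycle (branch T r c) xs"
  proof
    assume "\<exists>xs. graph_cycle (branch T r c) xs"
    then obtain xs where "graph_cycle (branch T r c) xs" by blast
    then have "graph_cycle T xs"
      using graph_path_mono[of _ xs T] sub by (auto simp: graph_cycle_def)
    with assms(1) show False by (auto simp: is_tree_def)
  qed
qed

lemma depth_le_branch:
  assumes "is_tree T" "c \<in> children T r" "depth_le T r (Suc h)"
  shows "depth_le (branch T r c) c h"
  unfolding depth_le_def
proof (intro allI impI)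
  have simple: "simple_graph T" using assms(1) by (simp add: is_tree_def)
  note sub = branch_subset[OF simple assms(2)]
  fix xs assume xs: "graph_path (branch T r c) xs \<and> hd xs = c"
  then have "graph_path T xs" "r \<notin> set xs"
    using graph_path_mono[of _ xs T] sub root_notin_branch[OF simple assms(2)]
    by (auto simp: graph_path_def)
  moreover have "{r, c} \<in> edges T" using assms(2) by (simp add: children_def)
  ultimately have "graph_path T (r # xs)"
    using graph_path_Cons[of T xs r] xs simple_graph_edgeD(1)[OF simple] by metis
  then have "length (r # xs) \<le> Suc (Suc h)"
    using assms(3) unfolding depth_le_def by (metis list.sel(1))
  then show "length xs \<le> Suc h" by simp
qed

lemma card_verts_branches:
  assumes "is_tree T" "r \<in> verts T"
  shows "card (verts T) = Suc (\<Sum>c\<in>children T r. card (verts (branch T r c)))"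
proof -
  have simple: "simple_graph T" using assms(1) by (simp add: is_tree_def)
  then have fin: "finite (verts T)" by (simp add: simple_graph_def)
  have "children T r \<subseteq> verts T"
    using simple_graph_edgeD(2)[OF simple] by (auto simp: children_def)
  with fin have finC: "finite (children T r)" by (rule rev_finite_subset)
  have finB: "finite (verts (branch T r c))" if "c \<in> children T r" for c
    using branch_subset(1)[OF simple that] fin by (rule finite_subset)
  have "r \<notin> (\<Union>c\<in>children T r. verts (branch T r c))"
    using root_notin_branch[OF simple] by blast
  then have "card (verts T) = Suc (card (\<Union>c\<in>children T r. verts (branch T r c)))"
    using finC finB by (subst verts_eq_branches[OF assms]) simp
  also have "card (\<Union>c\<in>children T r. verts (branch T r c)) =
      (\<Sum>c\<in>children T r. card (verts (branch T r c)))"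
    by (rule card_UN_disjoint) (use finC finB branches_disjoint[OF assms(1)] in auto)
  finally show ?thesis .
qed

text \<open>Two paths that leave \<open>r\<close> through different children run in disjoint branches, so one of them
reversed and the other can be concatenated.\<close>

lemma paths_through_root:
  assumes "is_tree T" "graph_path T (r # b # bs)" "graph_path T (r # c # cs)" "b \<noteq> c"
  shows "graph_path T (rev (b # bs) @ r # c # cs)"
proof -
  have simple: "simple_graph T" using assms(1) by (simp add: is_tree_def)
  note b = path_stays_in_branch[OF assms(2)]
  note c = path_stays_in_branch[OF assms(3)]
  have "set (b # bs) \<inter> set (c # cs) = {}"
    using branches_disjoint[OF assms(1) b(1) c(1) assms(4)] b(2) c(2) by blast
  moreover have "r \<notin> set (b # bs)"
    using assms(2) by (auto simp: graph_path_def)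
  moreover have "successively (\<lambda>x y. {x, y} \<in> edges T) (rev (b # bs))"
    using assms(2) unfolding successively_rev
    by (auto simp: graph_path_iff_successively insert_commute)
  moreover have "{b, r} \<in> edges T" 
    using b(1) by (simp add: children_def insert_commute)
  ultimately show ?thesis
    using assms(2,3)
    unfolding graph_path_iff_successively successively_append_iff by auto
qed

lemma length_path_le_card:
  assumes "simple_graph G" "graph_path G xs"
  shows "length xs \<le> card (verts G)"
  using assms distinct_card[of xs] card_mono[of "verts G" "set xs"]
  by (auto simp: graph_path_def simple_graph_def)

lemma tree_diameter_path:
  assumes "is_tree T"
  shows "\<And>xs. graph_path T xs \<Longrightarrow> length xs \<le> Suc (tree_diameter T)"
    and "\<exists>xs. graph_path T xs \<and> length xs = Suc (tree_diameter T)"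
proof -
  have simple: "simple_graph T" using assms(1) by (simp add: is_tree_def)
  define L where "L = {length xs - 1 | xs. graph_path T xs}"
  have "L \<subseteq> {..card (verts T)}"
    using length_path_le_card[OF simple] unfolding L_def by fastforce
  then have fin: "finite L" by (rule finite_subset) simp
  obtain v where "v \<in> verts T" using assms by (auto simp: is_tree_def connected_graph_def)
  then have "graph_path T [v]" by (simp add: graph_path_def)
  then have "L \<noteq> {}" by (auto simp: L_def)
  have d: "tree_diameter T = Max L" by (simp add: tree_diameter_def L_def)
  show "length xs \<le> Suc (tree_diameter T)" if "graph_path T xs" for xs
  proof -
    have "length xs - 1 \<in> L" using that by (auto simp: L_def)
    from Max_ge[OF fin this] show ?thesis by (simp add: d)
  qed
  have "tree_diameter T \<in> L" using Max_in[OF fin \<open>L \<noteq> {}\<close>] d by simp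
  then obtain xs where "graph_path T xs" "tree_diameter T = length xs - 1"
    by (auto simp: L_def)
  moreover have "xs \<noteq> []" using \<open>graph_path T xs\<close> by (simp add: graph_path_def)
  ultimately show "\<exists>xs. graph_path T xs \<and> length xs = Suc (tree_diameter T)"
    by (intro exI[of _ xs]) simp
qed

text \<open>The middle vertex of a longest path serves as the centre. A path that starts there can follow at
most one of the two halves of the longest path, so it extends the other half to a path. As that
path has at most \<open>d\<close> edges, the new part has at most \<open>\<lceil>d/2\<rceil>\<close> edges.\<close>

lemma tree_has_centre:
  assumes "is_tree T"
  shows "\<exists>r\<in>verts T. depth_le T r (Suc (tree_diameter T) div 2)"
proof -
  define d where "d = tree_diameter T"
  obtain xs where xs: "graph_path T xs" "length xs = Suc d"
    using tree_diameter_path(2)[OF assms] by (auto simp: d_def)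
  define as where "as = take (d div 2) xs"
  define r where "r = xs ! (d div 2)"
  define bs where "bs = drop (Suc (d div 2)) xs"
  have split: "xs = as @ r # bs"
    using xs(2) unfolding as_def r_def bs_def by (intro id_take_nth_drop) simp
  have len: "length as = d div 2" "length bs = Suc d div 2"
    using xs(2) by (auto simp: as_def bs_def)
  have r: "r \<in> verts T" using xs(1) split by (auto simp: graph_path_def)
  have A: "graph_path T (r # rev as)"
  proof -
    have "graph_path T (as @ [r])"
      using xs(1) unfolding graph_path_iff_successively split successively_append_iff by auto
    then have "graph_path T (rev (as @ [r]))"
      unfolding graph_path_iff_successively successively_rev by (simp add: insert_commute)
    then show ?thesis by simp
  qed
  have B: "graph_path T (r # bs)"
    using xs(1) unfolding graph_path_iff_successively split successively_append_iff by auto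
  have "depth_le T r (Suc d div 2)"
    unfolding depth_le_def
  proof (intro allI impI)
    fix ys assume ys: "graph_path T ys \<and> hd ys = r"
    then obtain zs where zs: "ys = r # zs" by (cases ys) (auto simp: graph_path_def)
    show "length ys \<le> Suc (Suc d div 2)"
    proof (cases "zs = [] \<or> as = []")
      case True
      \<comment> \<open>If the first half is empty then \<open>d \<le> 1\<close>, so the bound to prove is the diameter itself.\<close>
      then show ?thesis
        using tree_diameter_path(1)[OF assms, of ys] ys zs len(1) by (auto simp: d_def[symmetric])
    next
      case False
      then obtain c cs where c: "zs = c # cs" by (cases zs) auto
      from False obtain a as' where a: "rev as = a # as'" by (cases "rev as") auto
      have "length as > 0" using False by simp
      then have "length bs > 0" using len by linarith
      then obtain b bs' where b: "bs = b # bs'" by (cases bs) auto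
      have "a \<in> set as" using a by (simp flip: set_rev[of as])
      then have "a \<noteq> b"
        using xs(1) split b by (auto simp: graph_path_def)
      then consider "a \<noteq> c" | "b \<noteq> c" by blast
      then show ?thesis
      proof cases
        case 1
        have "graph_path T (rev (a # as') @ r # c # cs)"
          using paths_through_root[OF assms] A ys zs a c 1 by auto
        from tree_diameter_path(1)[OF assms this]
        have "length (a # as') + length zs \<le> d" using c by (simp add: d_def)
        moreover have "length (a # as') = d div 2" using a len by (metis length_rev)
        ultimately show ?thesis using zs by simp
      next
        case 2
        have "graph_path T (rev (b # bs') @ r # c # cs)"
          using paths_through_root[OF assms] B ys zs b c 2 by auto
        from tree_diameter_path(1)[OF assms this]
        have "length bs + length zs \<le> d" using b c by (simp add: d_def)
        then show ?thesis using zs len by simp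
      qed
    qed
  qed
  with r show ?thesis by (auto simp: d_def)
qed


section \<open>Wedges around a point\<close>

lemma edges_cross_sym: "edges_cross e f \<longleftrightarrow> edges_cross f e"
  unfolding edges_cross_def by (metis Int_commute)

text \<open>A line that weakly separates two segments and does not contain the first one misses the interior
of the first one. All non-crossing arguments reduce to this criterion.\<close>

lemma separated_not_edges_cross:
  assumes "\<And>x. x \<in> e \<Longrightarrow> w \<bullet> x \<le> k" "\<And>y. y \<in> f \<Longrightarrow> k \<le> w \<bullet> y" "\<exists>x\<in>e. w \<bullet> x < k"
  shows "\<not> edges_cross e f"
proof
  assume "edges_cross e f"
  then obtain a b c d z where e: "e = {a, b}" and f: "f = {c, d}"
    and z: "z \<in> open_segment a b" "z \<in> open_segment c d"
    unfolding edges_cross_def by blast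
  obtain s where s: "0 < s" "s < 1" "z = (1 - s) *\<^sub>R a + s *\<^sub>R b"
    using z(1) by (auto simp: in_segment)
  obtain t where t: "0 < t" "t < 1" "z = (1 - t) *\<^sub>R c + t *\<^sub>R d"
    using z(2) by (auto simp: in_segment)
  have "(1 - s) * (w \<bullet> a) \<le> (1 - s) * k" "s * (w \<bullet> b) \<le> s * k"
    using assms(1) s e by (auto intro!: mult_left_mono)
  moreover have "(1 - s) * (w \<bullet> a) < (1 - s) * k \<or> s * (w \<bullet> b) < s * k"
    using assms(3) s e by auto
  ultimately have "w \<bullet> z < (1 - s) * k + s * k"
    unfolding s(3) inner_add_right inner_scaleR_right by linarith
  then have "w \<bullet> z < k" by (simp add: algebra_simps)
  moreover have "(1 - t) * k \<le> (1 - t) * (w \<bullet> c)" "t * k \<le> t * (w \<bullet> d)"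
    using assms(2) t f by (auto intro!: mult_left_mono)
  then have "(1 - t) * k + t * k \<le> w \<bullet> z"
    unfolding t(3) inner_add_right inner_scaleR_right by linarith
  then have "k \<le> w \<bullet> z" by (simp add: algebra_simps)
  ultimately show False by simp
qed

text \<open>Among the directions \<open>(1, t)\<close>, each pair of points excludes at most one value of \<open>t\<close>. Such a
direction orders the points from left to right without ties.\<close>

lemma ex_injective_direction:
  fixes P :: "(real^2) set"
  assumes "finite P"
  shows "\<exists>u. inj_on (\<lambda>x. u \<bullet> x) P"
proof -
  define bad where "bad = (\<lambda>(x, y). - ((x - y) $ 1) / ((x - y) $ 2)) ` (P \<times> P)"
  have "finite bad" using assms by (simp add: bad_def)
  then obtain t where t: "t \<notin> bad" using ex_new_if_finite[OF infinite_UNIV_char_0] by blast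
  define u :: "real^2" where "u = vector [1, t]"
  have u: "u \<bullet> z = z $ 1 + t * z $ 2" for z
    by (simp add: u_def inner_vec_def sum_2 vector_2)
  have "inj_on (\<lambda>x. u \<bullet> x) P"
  proof (rule inj_onI, rule ccontr)
    fix x y assume xy: "x \<in> P" "y \<in> P" "u \<bullet> x = u \<bullet> y" "x \<noteq> y"
    then have eq: "(x - y) $ 1 + t * (x - y) $ 2 = 0"
      using u[of "x - y"] by (simp add: inner_diff_right)
    have "(x - y) $ 2 \<noteq> 0"
    proof
      assume "(x - y) $ 2 = 0"
      with eq xy(4) show False by (simp add: vec_eq_iff forall_2)
    qed
    with eq have "t = - ((x - y) $ 1) / ((x - y) $ 2)"
      by (simp add: field_simps)
    with xy t show False unfolding bad_def by auto
  qed
  then show ?thesis by blast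
qed

lemma ex_initial_subset:
  fixes key :: "'b \<Rightarrow> real"
  assumes "finite X" "inj_on key X" "k \<le> card X"
  shows "\<exists>S\<subseteq>X. card S = k \<and> (\<forall>x\<in>S. \<forall>y\<in>X - S. key x < key y)"
  using assms(3)
proof (induction k)
  case 0
  show ?case by (rule exI[of _ "{}"]) simp
next
  case (Suc k)
  then obtain S where S: "S \<subseteq> X" "card S = k" "\<forall>x\<in>S. \<forall>y\<in>X - S. key x < key y" by auto
  have finS: "finite S" using S(1) assms(1) by (rule finite_subset)
  have "X - S \<noteq> {}"
    using S Suc.prems assms(1) card_mono[OF finS, of X] by auto
  then obtain a where a: "a \<in> X - S" "\<forall>y\<in>X - S. key a \<le> key y"
    using assms(1) ex_is_arg_min_if_finite[of "X - S" key]
    by (auto simp: is_arg_min_linorder)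
  have "key a < key y" if "y \<in> X - insert a S" for y
    using a that assms(2) by (force simp: inj_on_def order.strict_iff_order)
  with S a finS show ?case
    by (intro exI[of _ "insert a S"]) auto
qed

lemma ex_consecutive_blocks:
  fixes key :: "'b \<Rightarrow> real"
  assumes "finite C" "finite X" "inj_on key X" "(\<Sum>c\<in>C. m c) \<le> card X"
  shows "\<exists>Y. \<forall>c\<in>C. Y c \<subseteq> X \<and> card (Y c) = m c \<and>
    (\<forall>c'\<in>C. c \<noteq> c' \<longrightarrow> (\<forall>x\<in>Y c. \<forall>y\<in>Y c'. key x < key y) \<or> (\<forall>x\<in>Y c. \<forall>y\<in>Y c'. key y < key x))"
  using assms
proof (induction C arbitrary: X rule: finite_induct)
  case (insert c C)
  then obtain S where S: "S \<subseteq> X" "card S = m c" "\<forall>x\<in>S. \<forall>y\<in>X - S. key x < key y"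
    using ex_initial_subset[of X key "m c"] by auto
  have "card (X - S) = card X - m c"
    using S insert.prems(1) by (metis card_Diff_subset finite_subset)
  with insert have "(\<Sum>c\<in>C. m c) \<le> card (X - S)" by simp
  moreover have "inj_on key (X - S)" using insert.prems(2) by (rule inj_on_subset) blast
  ultimately obtain Y where Y: "\<forall>c\<in>C. Y c \<subseteq> X - S \<and> card (Y c) = m c \<and>
    (\<forall>c'\<in>C. c \<noteq> c' \<longrightarrow> (\<forall>x\<in>Y c. \<forall>y\<in>Y c'. key x < key y) \<or> (\<forall>x\<in>Y c. \<forall>y\<in>Y c'. key y < key x))"
    using insert.IH[of "X - S"] insert.prems(1) by auto
  define Y' where "Y' = Y(c := S)"
  have Y'c: "Y' c = S" and Y'C: "\<And>d. d \<in> C \<Longrightarrow> Y' d = Y d"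
    using insert.hyps(2) by (auto simp: Y'_def)
  have first: "\<forall>x\<in>S. \<forall>y\<in>Y d. key x < key y" if "d \<in> C" for d
    using S(3) Y that by blast
  show ?case
    by (rule exI[of _ Y']) (use Y S first in \<open>auto simp: Y'c Y'C\<close>)
qed simp

text \<open>The tangent of the angle from \<open>u\<close> to \<open>q - p\<close>. On the half plane to the right of \<open>p\<close>, where the
denominator is positive, it orders the points by angle around \<open>p\<close>.\<close>

definition slope :: "real^2 \<Rightarrow> real^2 \<Rightarrow> real^2 \<Rightarrow> real" where
  "slope u p q = (vector [- u $ 2, u $ 1] \<bullet> (q - p)) / (u \<bullet> (q - p))"

text \<open>The line through \<open>p\<close> of slope \<open>k\<close> has the normal vector on the left-hand side, so this identity
says that comparing the slope of \<open>q\<close> with \<open>k\<close> decides on which side of this line \<open>q\<close> lies.\<close>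

lemma inner_line_through:
  fixes u p q :: "real^2"
  assumes "u \<bullet> p < u \<bullet> q"
  shows "(vector [- u $ 2, u $ 1] - k *\<^sub>R u) \<bullet> q - (vector [- u $ 2, u $ 1] - k *\<^sub>R u) \<bullet> p
    = (u \<bullet> (q - p)) * (slope u p q - k)"
proof -
  have "u \<bullet> (q - p) \<noteq> 0" using assms by (simp add: inner_diff_right)
  then have "(u \<bullet> (q - p)) * (slope u p q - k) =
      vector [- u $ 2, u $ 1] \<bullet> (q - p) - k * (u \<bullet> (q - p))"
    by (simp add: slope_def right_diff_distrib mult.commute)
  then show ?thesis by (simp add: inner_diff_left inner_diff_right right_diff_distrib)
qed

text \<open>Two points to the right of \<open>p\<close> with the same slope would be collinear with \<open>p\<close>.\<close>

lemma inj_on_slope: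
  fixes P :: "(real^2) set"
  assumes "general_position P" "p \<in> P"
  shows "inj_on (slope u p) {q \<in> P. u \<bullet> p < u \<bullet> q}"
proof (rule inj_onI, rule ccontr)
  fix x y assume x: "x \<in> {q \<in> P. u \<bullet> p < u \<bullet> q}" and y: "y \<in> {q \<in> P. u \<bullet> p < u \<bullet> q}"
    and eq: "slope u p x = slope u p y" and "x \<noteq> y"
  define s where "s = u \<bullet> (x - p)"
  define t where "t = u \<bullet> (y - p)"
  \<comment> \<open>The direction orthogonal to \<open>u\<close>, as in the definition of the slope.\<close>
  define v :: "real^2" where "v = vector [- u $ 2, u $ 1]"
  have st: "s > 0" "t > 0" using x y by (auto simp: s_def t_def inner_diff_right)
  define z where "z = t *\<^sub>R (x - p) - s *\<^sub>R (y - p)"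
  have "u \<bullet> z = 0" by (simp add: z_def inner_diff_right s_def t_def)
  moreover have "v \<bullet> z = 0"
  proof -
    have "(v \<bullet> (x - p)) / s = (v \<bullet> (y - p)) / t"
      using eq by (simp add: slope_def s_def t_def v_def)
    then have "t * (v \<bullet> (x - p)) = s * (v \<bullet> (y - p))"
      using st by (simp add: field_simps)
    then show ?thesis by (simp add: z_def inner_diff_right)
  qed
  ultimately have z12: "u $ 1 * z $ 1 + u $ 2 * z $ 2 = 0" "- u $ 2 * z $ 1 + u $ 1 * z $ 2 = 0"
    by (simp_all add: inner_vec_def sum_2 v_def vector_2)
  have "((u $ 1)\<^sup>2 + (u $ 2)\<^sup>2) * z $ 1 = 0" "((u $ 1)\<^sup>2 + (u $ 2)\<^sup>2) * z $ 2 = 0"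
    using z12 by algebra+
  moreover have "(u $ 1)\<^sup>2 + (u $ 2)\<^sup>2 \<noteq> 0"
  proof
    assume "(u $ 1)\<^sup>2 + (u $ 2)\<^sup>2 = 0"
    then have "u = 0" by (simp add: sum_power2_eq_zero_iff vec_eq_iff forall_2)
    with st show False by (simp add: s_def)
  qed
  ultimately have "z $ 1 = 0" "z $ 2 = 0" by (metis mult_eq_0_iff)+
  then have "z = 0" by (simp add: vec_eq_iff forall_2)
  then have "t *\<^sub>R (x - p) = s *\<^sub>R (y - p)" by (simp add: z_def)
  then have "(1 / s) *\<^sub>R (t *\<^sub>R (x - p)) = (1 / s) *\<^sub>R (s *\<^sub>R (y - p))" by (rule arg_cong)
  then have "y - p = (t / s) *\<^sub>R (x - p)" using st by simp
  then have "collinear {0, x - p, y - p}" unfolding collinear_lemma by blast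
  then have "collinear {x, p, y}" by (simp add: collinear_3)
  moreover have "x \<noteq> p" "y \<noteq> p" using x y by auto
  ultimately show False
    using assms x y \<open>x \<noteq> y\<close> unfolding general_position_def by blast
qed

lemma ex_strictly_between:
  fixes A B :: "real set"
  assumes "finite A" "finite B" "\<forall>a\<in>A. \<forall>b\<in>B. a < b"
  shows "\<exists>k. (\<forall>a\<in>A. a < k) \<and> (\<forall>b\<in>B. k < b)"
proof (cases "A = {} \<or> B = {}")
  case False
  then have "Max A < Min B" using assms by simp
  then obtain k where "Max A < k" "k < Min B" using dense by blast
  with False assms(1,2) show ?thesis by (intro exI[of _ k]) auto
next
  case True
  define l where "l = Min (insert 0 B)"
  define g where "g = Max (insert 0 A)"
  have "l - 1 < b" if "b \<in> B" for b
  proof -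
    have "l \<le> b" unfolding l_def by (rule Min_le) (use assms(2) that in auto)
    then show ?thesis by simp
  qed
  moreover have "a < g + 1" if "a \<in> A" for a
  proof -
    have "a \<le> g" unfolding g_def by (rule Max_ge) (use assms(1) that in auto)
    then show ?thesis by simp
  qed
  ultimately show ?thesis using True by blast
qed

text \<open>Sort the points to the right of \<open>p\<close> by angle around \<open>p\<close> and cut the sorted sequence into blocks
of prescribed sizes. The blocks lie in disjoint wedges with apex \<open>p\<close>, and a line through \<open>p\<close>
separates any two of them.\<close>

lemma ex_wedges:
  fixes P X :: "(real^2) set"
  assumes "general_position P" "p \<in> P" "X \<subseteq> {q \<in> P. u \<bullet> p < u \<bullet> q}"
    and "finite C" "(\<Sum>c\<in>C. m c) \<le> card X"
  shows "\<exists>Y. \<forall>c\<in>C. Y c \<subseteq> X \<and> card (Y c) = m c \<and>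
    (\<forall>c'\<in>C. c \<noteq> c' \<longrightarrow>
      (\<exists>w. (\<forall>x\<in>Y c. w \<bullet> x < w \<bullet> p) \<and> (\<forall>y\<in>Y c'. w \<bullet> p < w \<bullet> y)))"
proof -
  have finX: "finite X"
    using assms(1,3) by (auto simp: general_position_def intro: finite_subset)
  have inj: "inj_on (slope u p) X"
    using inj_on_slope[OF assms(1,2)] assms(3) by (rule inj_on_subset)
  obtain Y where Y: "\<And>c. c \<in> C \<Longrightarrow> Y c \<subseteq> X" "\<And>c. c \<in> C \<Longrightarrow> card (Y c) = m c"
    and ord: "\<And>c c'. c \<in> C \<Longrightarrow> c' \<in> C \<Longrightarrow> c \<noteq> c' \<Longrightarrow>
      (\<forall>x\<in>Y c. \<forall>y\<in>Y c'. slope u p x < slope u p y) \<or>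
      (\<forall>x\<in>Y c. \<forall>y\<in>Y c'. slope u p y < slope u p x)"
    using ex_consecutive_blocks[OF assms(4) finX inj assms(5)] by blast
  have sep: "\<exists>w. (\<forall>x\<in>A. w \<bullet> x < w \<bullet> p) \<and> (\<forall>y\<in>B. w \<bullet> p < w \<bullet> y)"
    if AB: "A \<subseteq> X" "B \<subseteq> X" "\<forall>x\<in>A. \<forall>y\<in>B. slope u p x < slope u p y" for A B
  proof -
    have fin: "finite A" "finite B" using AB finX by (auto intro: finite_subset)
    obtain k where k: "\<forall>x\<in>A. slope u p x < k" "\<forall>y\<in>B. k < slope u p y"
      using ex_strictly_between[of "slope u p ` A" "slope u p ` B"] fin AB(3) by auto
    define w where "w = vector [- u $ 2, u $ 1] - k *\<^sub>R u"
    have pos: "u \<bullet> (q - p) > 0" if "q \<in> X" for q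
      using that assms(3) by (auto simp: inner_diff_right)
    have diff: "w \<bullet> q - w \<bullet> p = (u \<bullet> (q - p)) * (slope u p q - k)" if "q \<in> X" for q
      using inner_line_through[of u p q k] that assms(3) by (auto simp: w_def)
    have "w \<bullet> x - w \<bullet> p < 0" if "x \<in> A" for x
    proof -
      have "x \<in> X" using that AB(1) by blast
      then show ?thesis
        unfolding diff[OF \<open>x \<in> X\<close>] using pos k(1) that by (simp add: mult_pos_neg)
    qed
    moreover have "w \<bullet> y - w \<bullet> p > 0" if "y \<in> B" for y
    proof -
      have "y \<in> X" using that AB(2) by blast
      then show ?thesis
        unfolding diff[OF \<open>y \<in> X\<close>] using pos k(2) that by simp
    qed
    ultimately show ?thesis by (intro exI[of _ w]) auto
  qed
  have "\<exists>w. (\<forall>x\<in>Y c. w \<bullet> x < w \<bullet> p) \<and> (\<forall>y\<in>Y c'. w \<bullet> p < w \<bullet> y)"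
    if c: "c \<in> C" "c' \<in> C" "c \<noteq> c'" for c c'
    using ord[OF c]
  proof
    assume "\<forall>x\<in>Y c. \<forall>y\<in>Y c'. slope u p y < slope u p x"
    then obtain w where "\<forall>x\<in>Y c'. w \<bullet> x < w \<bullet> p" "\<forall>y\<in>Y c. w \<bullet> p < w \<bullet> y"
      using sep[OF Y(1)[OF c(2)] Y(1)[OF c(1)]] by blast
    then show ?thesis by (intro exI[of _ "- w"]) auto
  qed (rule sep[OF Y(1)[OF c(1)] Y(1)[OF c(2)]])
  with Y show ?thesis by (intro exI[of _ Y]) blast
qed


section \<open>Drawings of rooted trees\<close>

text \<open>The map \<open>f\<close> draws \<open>T\<close> without crossings on points of \<open>P\<close> with edges satisfying \<open>E\<close>. The condition
that the root is extremal in direction \<open>u\<close> makes the drawing extensible: every point strictly to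
the left of the root sees the root without an edge of the drawing in between.\<close>

definition rooted_drawing ::
    "((real^2) set \<Rightarrow> bool) \<Rightarrow> real^2 \<Rightarrow> 'a sgraph \<Rightarrow> 'a \<Rightarrow> ('a \<Rightarrow> real^2) \<Rightarrow> (real^2) set \<Rightarrow> bool"
  where
  "rooted_drawing E u T r f P \<longleftrightarrow>
     inj_on f (verts T) \<and> f ` verts T \<subseteq> P \<and> (\<forall>e\<in>edges T. E (f ` e)) \<and>
     (\<forall>v\<in>verts T. u \<bullet> f r \<le> u \<bullet> f v) \<and>
     (\<forall>e\<in>edges T. \<forall>e'\<in>edges T. \<not> edges_cross (f ` e) (f ` e'))"

lemma rooted_drawing_mono:
  "rooted_drawing E u T r f Y \<Longrightarrow> Y \<subseteq> P \<Longrightarrow> rooted_drawing E u T r f P"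
  unfolding rooted_drawing_def by blast

lemma finite_children:
  assumes "simple_graph T"
  shows "finite (children T r)"
proof (rule finite_subset)
  show "children T r \<subseteq> verts T"
    using simple_graph_edgeD(2)[OF assms] by (auto simp: children_def)
qed (use assms in \<open>simp add: simple_graph_def\<close>)

lemma glue_functions:
  assumes "\<And>c. c \<in> C \<Longrightarrow> r \<notin> V c"
    and "\<And>c c'. c \<in> C \<Longrightarrow> c' \<in> C \<Longrightarrow> c \<noteq> c' \<Longrightarrow> V c \<inter> V c' = {}"
  shows "\<exists>f. f r = p \<and> (\<forall>c\<in>C. \<forall>v\<in>V c. f v = F c v)"
proof -
  define f where "f v = (if v = r then p else F (THE c. c \<in> C \<and> v \<in> V c) v)" for v
  have "(THE c. c \<in> C \<and> v \<in> V c) = c" if "c \<in> C" "v \<in> V c" for c v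
    using that assms(2) by (intro the_equality) auto
  moreover have "f r = p" by (simp add: f_def)
  moreover have "v \<noteq> r" if "c \<in> C" "v \<in> V c" for c v using that assms(1) by blast
  ultimately show ?thesis by (intro exI[of _ f]) (simp add: f_def)
qed

text \<open>A point \<open>p\<close> with many neighbours to its right becomes the root of a drawing of \<open>T\<close>: the neighbours
are distributed to disjoint wedges at \<open>p\<close>, one for each branch, and each branch is drawn in its
wedge. Its root is then automatically a neighbour of \<open>p\<close>. Different wedges are separated by lines
through \<open>p\<close>. Within a wedge, the edge from \<open>p\<close> to the root of the branch lies to the left of the
branch, because the root of the branch is its leftmost point. Since \<open>p\<close> lies to the left of all
its chosen neighbours, the new drawing again has its root at the left.\<close>

lemma join_branches:
  assumes T: "is_tree T" "r \<in> verts T" and P: "general_position P" "p \<in> P"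
    and X: "X = {q \<in> P. u \<bullet> p < u \<bullet> q \<and> E {p, q}}"
    and card_X: "(\<Sum>c\<in>children T r. m c) \<le> card X"
    and draw: "\<And>c Y. c \<in> children T r \<Longrightarrow> Y \<subseteq> X \<Longrightarrow> card Y = m c \<Longrightarrow>
      \<exists>f. rooted_drawing E u (branch T r c) c f Y"
  shows "\<exists>f. rooted_drawing E u T r f P"
proof -
  have simple: "simple_graph T" using T(1) by (simp add: is_tree_def)
  let ?C = "children T r"
  let ?B = "\<lambda>c. branch T r c"
  have X_right: "X \<subseteq> {q \<in> P. u \<bullet> p < u \<bullet> q}" using X by blast
  obtain Y where Y_all: "\<forall>c\<in>?C. Y c \<subseteq> X \<and> card (Y c) = m c \<and>
    (\<forall>c'\<in>?C. c \<noteq> c' \<longrightarrow>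
      (\<exists>w. (\<forall>x\<in>Y c. w \<bullet> x < w \<bullet> p) \<and> (\<forall>y\<in>Y c'. w \<bullet> p < w \<bullet> y)))"
    using ex_wedges[OF P X_right finite_children[OF simple] card_X] by (elim exE)
  have Y: "\<And>c. c \<in> ?C \<Longrightarrow> Y c \<subseteq> X" "\<And>c. c \<in> ?C \<Longrightarrow> card (Y c) = m c"
    using Y_all by simp_all
  have sep: "\<exists>w. (\<forall>x\<in>Y c. w \<bullet> x < w \<bullet> p) \<and> (\<forall>y\<in>Y c'. w \<bullet> p < w \<bullet> y)"
    if "c \<in> ?C" "c' \<in> ?C" "c \<noteq> c'" for c c'
    using Y_all that by simp
  have "\<forall>c\<in>?C. \<exists>f. rooted_drawing E u (?B c) c f (Y c)"
    using draw Y by blast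
  then obtain F where F: "\<And>c. c \<in> ?C \<Longrightarrow> rooted_drawing E u (?B c) c (F c) (Y c)"
    by metis
  have "\<exists>f. f r = p \<and> (\<forall>c\<in>?C. \<forall>v\<in>verts (?B c). f v = F c v)"
    by (rule glue_functions) (use root_notin_branch[OF simple] branches_disjoint[OF T(1)] in auto)
  then obtain f where fr: "f r = p"
    and f: "\<And>c v. c \<in> ?C \<Longrightarrow> v \<in> verts (?B c) \<Longrightarrow> f v = F c v"
    by (elim exE conjE) blast
  have im: "f v \<in> Y c" if "c \<in> ?C" "v \<in> verts (?B c)" for c v
    using F[OF that(1)] f[OF that] that(2) by (auto simp: rooted_drawing_def)
  have f_edge: "f ` e = F c ` e" "f ` e \<subseteq> Y c" "f ` e \<noteq> {}" if "c \<in> ?C" "e \<in> edges (?B c)" for c e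
  proof -
    have e: "e \<subseteq> verts (?B c)" "e \<in> edges T" using that(2) by (auto simp: branch_def)
    then show "f ` e = F c ` e" using f[OF that(1)] by (intro image_cong) auto
    show "f ` e \<subseteq> Y c" using im[OF that(1)] e(1) by blast
    show "f ` e \<noteq> {}" using e(2) simple by (auto simp: simple_graph_def)
  qed
  have p_less: "u \<bullet> p < u \<bullet> y" if "c \<in> ?C" "y \<in> Y c" for c y
    using Y(1)[OF that(1)] that(2) X by blast
  have VT: "verts T = insert r (\<Union>c\<in>?C. verts (?B c))" by (rule verts_eq_branches[OF T])
  have ET: "edges T = (\<Union>c\<in>?C. insert {r, c} (edges (?B c)))" by (rule edges_eq_branches[OF T])
  have inj: "inj_on f (\<Union>c\<in>?C. verts (?B c))"
  proof (rule inj_onI)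
    fix v v' assume "v \<in> (\<Union>c\<in>?C. verts (?B c))" "v' \<in> (\<Union>c\<in>?C. verts (?B c))"
      and eq: "f v = f v'"
    then obtain c c' where c: "c \<in> ?C" "v \<in> verts (?B c)" "c' \<in> ?C" "v' \<in> verts (?B c')"
      by blast
    show "v = v'"
    proof (cases "c = c'")
      case True
      then show ?thesis
        using F[OF c(1)] f[OF c(1,2)] f[OF c(3,4)] c eq by (auto simp: rooted_drawing_def inj_on_def)
    next
      case False
      with sep[OF c(1,3)] obtain w where
        "\<forall>x\<in>Y c. w \<bullet> x < w \<bullet> p" "\<forall>y\<in>Y c'. w \<bullet> p < w \<bullet> y" by blast
      then show ?thesis using im[OF c(1,2)] im[OF c(3,4)] eq by force
    qed
  qed
  have "inj_on f (verts T)"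
    unfolding VT inj_on_insert
  proof
    show "f r \<notin> f ` ((\<Union>c\<in>?C. verts (?B c)) - {r})"
    proof
      assume "f r \<in> f ` ((\<Union>c\<in>?C. verts (?B c)) - {r})"
      then obtain c v where c: "c \<in> ?C" "v \<in> verts (?B c)" and "p = f v" unfolding fr by blast
      with p_less[OF c(1) im[OF c]] show False by simp
    qed
  qed (rule inj)
  moreover have "f ` verts T \<subseteq> P"
  proof -
    have "f v \<in> P" if "c \<in> ?C" "v \<in> verts (?B c)" for c v
      using im[OF that] Y(1)[OF that(1)] X by blast
    then show ?thesis unfolding VT image_insert image_UN using fr P(2) by blast
  qed
  moreover have "E (f ` e)" if "e \<in> edges T" for e
  proof -
    from that obtain c where c: "c \<in> ?C" "e = {r, c} \<or> e \<in> edges (?B c)"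
      unfolding ET by blast
    from c(2) show ?thesis
    proof
      assume "e = {r, c}"
      moreover have "f c \<in> X" using im[OF c(1) child_in_branch] Y(1)[OF c(1)] by blast
      ultimately show ?thesis using X fr by simp
    next
      assume "e \<in> edges (?B c)"
      then show ?thesis using F[OF c(1)] f_edge(1)[OF c(1)] by (auto simp: rooted_drawing_def)
    qed
  qed
  moreover have "u \<bullet> f r \<le> u \<bullet> f v" if "v \<in> verts T" for v
  proof (cases "v = r")
    case False
    have "v \<in> insert r (\<Union>c\<in>?C. verts (?B c))" using that by (simp only: VT)
    with False obtain c where c: "c \<in> ?C" "v \<in> verts (?B c)" by blast
    show ?thesis using p_less[OF c(1) im[OF c]] fr by simp
  qed simp
  moreover have "\<not> edges_cross (f ` e) (f ` e')" if "e \<in> edges T" "e' \<in> edges T" for e e'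
  proof -
    \<comment> \<open>The edge from the root to a child against an edge of the branch of that child: the line
      orthogonal to \<open>u\<close> through the child separates them.\<close>
    have spoke: "\<not> edges_cross (f ` {r, c}) (f ` e)" if c: "c \<in> ?C" "e \<in> edges (?B c)" for c e
    proof (rule separated_not_edges_cross[where w = u and k = "u \<bullet> f c"])
      have less: "u \<bullet> f r < u \<bullet> f c"
        using p_less[OF c(1) im[OF c(1) child_in_branch]] fr by simp
      show "\<And>x. x \<in> f ` {r, c} \<Longrightarrow> u \<bullet> x \<le> u \<bullet> f c" using less by auto
      show "\<exists>x\<in>f ` {r, c}. u \<bullet> x < u \<bullet> f c" using less by auto
      fix y assume "y \<in> f ` e"
      then obtain v where "v \<in> verts (?B c)" "y = f v" using c(2) by (auto simp: branch_def)
      then show "u \<bullet> f c \<le> u \<bullet> y"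
        using F[OF c(1)] f[OF c(1)] child_in_branch[of c T r] by (auto simp: rooted_drawing_def)
    qed
    obtain c where c: "c \<in> ?C" "e = {r, c} \<or> e \<in> edges (?B c)"
      using \<open>e \<in> edges T\<close> unfolding ET UN_iff insert_iff by blast
    obtain c' where c': "c' \<in> ?C" "e' = {r, c'} \<or> e' \<in> edges (?B c')"
      using \<open>e' \<in> edges T\<close> unfolding ET UN_iff insert_iff by blast
    show ?thesis
    proof (cases "c = c'")
      case True
      have "\<not> edges_cross (f ` e) (f ` e')" if "e \<in> edges (?B c)" "e' \<in> edges (?B c)"
        using F[OF c(1)] f_edge(1)[OF c(1)] that by (auto simp: rooted_drawing_def)
      moreover have "\<not> edges_cross (f ` {r, c}) (f ` {r, c})" by (simp add: edges_cross_def)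
      ultimately show ?thesis
        using c c' True spoke[OF c(1)] edges_cross_sym by metis
    next
      case False
      have sub: "f ` e \<subseteq> insert p (Y c) \<and> f ` e \<inter> Y c \<noteq> {}"
        if "c \<in> ?C" "e = {r, c} \<or> e \<in> edges (?B c)" for c e
        using that(2)
      proof
        assume "e = {r, c}"
        then show ?thesis using im[OF that(1) child_in_branch] fr by auto
      next
        assume "e \<in> edges (?B c)"
        from f_edge(2,3)[OF that(1) this] show ?thesis by auto
      qed
      obtain w where w: "\<forall>x\<in>Y c. w \<bullet> x < w \<bullet> p" "\<forall>y\<in>Y c'. w \<bullet> p < w \<bullet> y"
        using sep[OF c(1) c'(1) False] by blast
      show ?thesis
      proof (rule separated_not_edges_cross[where w = w and k = "w \<bullet> p"])
        show "w \<bullet> x \<le> w \<bullet> p" if "x \<in> f ` e" for x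
          using sub[OF c] w(1) that by (auto intro: less_imp_le)
        show "w \<bullet> p \<le> w \<bullet> y" if "y \<in> f ` e'" for y
          using sub[OF c'] w(2) that by (auto intro: less_imp_le)
        show "\<exists>x\<in>f ` e. w \<bullet> x < w \<bullet> p" using sub[OF c] w(1) by blast
      qed
    qed
  qed
  ultimately have "rooted_drawing E u T r f P" by (simp add: rooted_drawing_def)
  then show ?thesis by blast
qed

section \<open>The recursion for a red and a blue tree\<close>

text \<open>Each pair of points is counted once, either as an edge with \<open>col\<close> at its left end or as an edge
without it at its right end. If all degrees in question were at most \<open>a - 1\<close> and \<open>b - 1\<close>, there
would be at most \<open>N (a + b - 2)\<close> pairs, whereas \<open>N (N - 1) / 2\<close> exceeds this for
\<open>N \<ge> 2 (a + b) - 2\<close>.\<close>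

lemma ex_large_degree:
  assumes "finite P" "inj_on (\<lambda>x. u \<bullet> x) P" "1 \<le> a" "1 \<le> b" "2 * (a + b) \<le> card P + 2" "P \<noteq> {}"
  shows "(\<exists>p\<in>P. a \<le> card {q \<in> P. u \<bullet> p < u \<bullet> q \<and> col {p, q}}) \<or>
    (\<exists>p\<in>P. b \<le> card {q \<in> P. - u \<bullet> p < - u \<bullet> q \<and> \<not> col {p, q}})"
proof (rule ccontr)
  assume neg: "\<not> ?thesis"
  define S where "S = {(p, q). p \<in> P \<and> q \<in> P \<and> u \<bullet> p < u \<bullet> q}"
  define R where "R = (SIGMA p:P. {q \<in> P. u \<bullet> p < u \<bullet> q \<and> col {p, q}})"
  define B where "B = (SIGMA p:P. {q \<in> P. - u \<bullet> p < - u \<bullet> q \<and> \<not> col {p, q}})"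
  define N where "N = card P"
  have fin: "finite R" "finite B" "finite S"
    using assms(1) by (auto simp: R_def B_def S_def intro: finite_subset[of _ "P \<times> P"])
  have "card {q \<in> P. u \<bullet> p < u \<bullet> q \<and> col {p, q}} \<le> a - 1" if "p \<in> P" for p
    using neg that by (auto simp: not_le)
  then have "card R \<le> N * (a - 1)"
    unfolding R_def N_def using assms(1) sum_bounded_above[of P _ "a - 1"] by simp
  moreover have "card {q \<in> P. - u \<bullet> p < - u \<bullet> q \<and> \<not> col {p, q}} \<le> b - 1" if "p \<in> P" for p
    using neg that by (auto simp: not_le)
  then have "card B \<le> N * (b - 1)"
    unfolding B_def N_def using assms(1) sum_bounded_above[of P _ "b - 1"] by simp
  moreover have "card S \<le> card R + card B"
  proof -
    have "S \<subseteq> R \<union> prod.swap ` B"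
      by (force simp: S_def R_def B_def insert_commute image_iff)
    then have "card S \<le> card (R \<union> prod.swap ` B)" using fin by (intro card_mono) auto
    also have "\<dots> \<le> card R + card (prod.swap ` B)" by (rule card_Un_le)
    also have "card (prod.swap ` B) \<le> card B" using fin by (intro card_image_le)
    finally show ?thesis by simp
  qed
  moreover have "N * (N - 1) \<le> 2 * card S"
  proof -
    have "P \<times> P - Id_on P \<subseteq> S \<union> prod.swap ` S"
    proof
      fix z assume "z \<in> P \<times> P - Id_on P"
      then obtain x y where z: "z = (x, y)" "x \<in> P" "y \<in> P" "x \<noteq> y" by auto
      then have "u \<bullet> x \<noteq> u \<bullet> y" using assms(2) by (auto simp: inj_on_def)
      then show "z \<in> S \<union> prod.swap ` S" using z by (force simp: S_def image_iff)
    qed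
    then have "card (P \<times> P - Id_on P) \<le> card (S \<union> prod.swap ` S)"
      using fin by (intro card_mono) auto
    also have "\<dots> \<le> card S + card (prod.swap ` S)" by (rule card_Un_le)
    also have "card (prod.swap ` S) \<le> card S" using fin by (intro card_image_le)
    finally have "card (P \<times> P - Id_on P) \<le> 2 * card S" by simp
    moreover have "card (P \<times> P - Id_on P) = N * N - N"
    proof -
      have "Id_on P = (\<lambda>x. (x, x)) ` P" by auto
      then have "card (Id_on P) = N" by (simp add: N_def card_image inj_on_def)
      moreover have "Id_on P \<subseteq> P \<times> P" by auto
      ultimately show ?thesis
        using assms(1) by (subst card_Diff_subset)
          (auto simp: N_def card_cartesian_product intro: finite_subset[of _ "P \<times> P"])
    qed
    ultimately show ?thesis by (simp add: diff_mult_distrib2)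
  qed
  ultimately have "N * (N - 1) \<le> 2 * (N * (a - 1) + N * (b - 1))"
    by (meson add_mono le_trans mult_le_mono2)
  also have "\<dots> = N * (2 * (a - 1) + 2 * (b - 1))" by (simp add: algebra_simps)
  finally have "N * (N - 1) \<le> N * (2 * (a - 1) + 2 * (b - 1))" .
  moreover have "N > 0" using assms(1,6) by (simp add: N_def card_gt_0_iff)
  ultimately have "N - 1 \<le> 2 * (a - 1) + 2 * (b - 1)" by simp
  with assms(3-5) \<open>N > 0\<close> show False unfolding N_def by presburger
qed

text \<open>The number of points that suffices for trees with \<open>n1\<close> and \<open>n2\<close> vertices, rooted with depths at
most \<open>h1\<close> and \<open>h2\<close>. If one of the trees is a single vertex then one point is enough. Otherwise the
recursion costs a factor of \<open>4\<close> for each level, with one exception that saves small trees: for two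
stars with \<open>n1\<close> and \<open>n2\<close> vertices, the degree argument needs only \<open>2 (n1 + n2) - 6 \<le> n1 n2\<close>
points, so that the power of \<open>4\<close> starts at depths \<open>h1 = h2 = 1\<close> with exponent \<open>0\<close>.\<close>

definition drawing_bound :: "nat \<Rightarrow> nat \<Rightarrow> nat \<Rightarrow> nat \<Rightarrow> nat" where
  "drawing_bound n1 h1 n2 h2 = (if h1 = 0 \<or> h2 = 0 then 1 else n1 * n2 * 4 ^ (h1 + h2 - 2))"

lemma drawing_bound_commute: "drawing_bound n1 h1 n2 h2 = drawing_bound n2 h2 n1 h1"
  by (simp add: drawing_bound_def ac_simps)

lemma drawing_bound_pos: "1 \<le> n1 \<Longrightarrow> 1 \<le> n2 \<Longrightarrow> 1 \<le> drawing_bound n1 h1 n2 h2"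
  by (simp add: drawing_bound_def)

text \<open>The bound is linear in the number of vertices, so the estimate for the sum over the branches does
not depend on how the vertices are distributed among them.\<close>

lemma sum_drawing_bound_le:
  assumes "\<And>c. c \<in> C \<Longrightarrow> 1 \<le> k c" "(\<Sum>c\<in>C. k c) \<le> n1" "1 \<le> n2" "1 \<le> h1 + h2"
  shows "(\<Sum>c\<in>C. drawing_bound (k c) h1 n2 (Suc h2)) \<le> n1 * n2 * 4 ^ (h1 + h2 - 1)"
proof -
  have "drawing_bound (k c) h1 n2 (Suc h2) \<le> k c * n2 * 4 ^ (h1 + h2 - 1)" if "c \<in> C" for c
    using assms(1)[OF that] assms(3) by (simp add: drawing_bound_def)
  then have "(\<Sum>c\<in>C. drawing_bound (k c) h1 n2 (Suc h2)) \<le> (\<Sum>c\<in>C. k c * n2 * 4 ^ (h1 + h2 - 1))"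
    by (rule sum_mono)
  also have "\<dots> = (\<Sum>c\<in>C. k c) * n2 * 4 ^ (h1 + h2 - 1)" by (simp add: sum_distrib_right)
  also have "\<dots> \<le> n1 * n2 * 4 ^ (h1 + h2 - 1)" using assms(2) by simp
  finally show ?thesis .
qed

text \<open>The two sums are the degrees that let a point become the root of the first or of the second tree.
The case \<open>h1 = h2 = 0\<close> concerns two stars and comes down to \<open>0 \<le> (n1 - 2) (n2 - 2) + 2\<close>; in the
other cases each sum is at most a quarter of the bound on the right-hand side.\<close>

lemma drawing_bound_step:
  assumes C: "\<And>c. c \<in> C \<Longrightarrow> 1 \<le> k c" "n1 = Suc (\<Sum>c\<in>C. k c)" "finite C" "C \<noteq> {}"
    and D: "\<And>d. d \<in> D \<Longrightarrow> 1 \<le> l d" "n2 = Suc (\<Sum>d\<in>D. l d)" "finite D" "D \<noteq> {}"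
  shows "2 * ((\<Sum>c\<in>C. drawing_bound (k c) h1 n2 (Suc h2)) +
      (\<Sum>d\<in>D. drawing_bound n1 (Suc h1) (l d) h2))
    \<le> drawing_bound n1 (Suc h1) n2 (Suc h2) + 2"
proof (cases "h1 + h2 = 0")
  case True
  have "(\<Sum>c\<in>C. 1) \<le> (\<Sum>c\<in>C. k c)" using C(1) by (rule sum_mono)
  moreover have "card C > 0" using C(3,4) by (simp add: card_gt_0_iff)
  ultimately have c: "card C \<le> n1 - 1" "2 \<le> n1" using C(2) by auto
  have "(\<Sum>d\<in>D. 1) \<le> (\<Sum>d\<in>D. l d)" using D(1) by (rule sum_mono)
  moreover have "card D > 0" using D(3,4) by (simp add: card_gt_0_iff)
  ultimately have d: "card D \<le> n2 - 1" "2 \<le> n2" using D(2) by auto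
  from c(2) d(2) obtain x y where xy: "n1 = x + 2" "n2 = y + 2" by (metis le_iff_add add.commute)
  have "2 * (card C + card D) \<le> n1 * n2 + 2"
    using c(1) d(1) unfolding xy by (simp add: algebra_simps)
  then show ?thesis using True by (simp add: drawing_bound_def)
next
  case False
  then obtain e where e: "h1 + h2 = Suc e" by (cases "h1 + h2") auto
  have n: "1 \<le> n1" "1 \<le> n2" using C(2) D(2) by auto
  have "(\<Sum>c\<in>C. drawing_bound (k c) h1 n2 (Suc h2)) \<le> n1 * n2 * 4 ^ e"
    using sum_drawing_bound_le[of C k n1 n2 h1 h2] C n e by simp
  moreover have "(\<Sum>d\<in>D. drawing_bound n1 (Suc h1) (l d) h2) \<le> n2 * n1 * 4 ^ e"
    using sum_drawing_bound_le[of D l n2 n1 h2 h1] D n e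
    by (simp add: drawing_bound_commute[of n1 "Suc h1"] add.commute)
  moreover have "drawing_bound n1 (Suc h1) n2 (Suc h2) = 4 * (n1 * n2 * 4 ^ e)"
    using e by (simp add: drawing_bound_def)
  ultimately show ?thesis by (simp add: ac_simps)
qed

lemma card_branch_pos:
  assumes "is_tree T" "c \<in> children T r"
  shows "1 \<le> card (verts (branch T r c))"
  using is_tree_branch[OF assms] by (simp add: is_tree_def connected_graph_def simple_graph_def
      Suc_le_eq card_gt_0_iff)

lemma draw_childless:
  assumes "is_tree T" "r \<in> verts T" "children T r = {}" "p \<in> P"
  shows "\<exists>f. rooted_drawing E u T r f P"
  using verts_eq_branches[OF assms(1,2)] edges_eq_branches[OF assms(1,2)] assms(3,4)
  by (intro exI[of _ "\<lambda>_. p"]) (simp add: rooted_drawing_def)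

lemma depth_le_0_childless:
  assumes "is_tree T" "r \<in> verts T" "depth_le T r 0"
  shows "children T r = {}"
proof (rule ccontr)
  assume "children T r \<noteq> {}"
  then obtain c where c: "{r, c} \<in> edges T" by (auto simp: children_def)
  then have "graph_path T [r, c]"
    using assms(1) simple_graph_edgeD[of T r c]
    by (auto simp: graph_path_iff_successively is_tree_def)
  with assms(3) show False unfolding depth_le_def by fastforce
qed

text \<open>Red trees grow to the right of their root and blue trees to the left; this opposite orientation
makes the count of \<open>ex_large_degree\<close> work. At a point with enough red neighbours to its right,
every block of these neighbours contains the intended branch of the first tree in red, unless some
block already contains the second tree in blue; and symmetrically. The induction hypothesis is
applied to a block, with one branch in place of the tree that it belongs to.\<close>

lemma red_or_blue_drawing:
  fixes T1 :: "'a sgraph" and T2 :: "'b sgraph"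
  assumes "is_tree T1" "r1 \<in> verts T1" "depth_le T1 r1 h1"
    and "is_tree T2" "r2 \<in> verts T2" "depth_le T2 r2 h2"
    and "general_position P" "inj_on (\<lambda>x. u \<bullet> x) P"
    and "drawing_bound (card (verts T1)) h1 (card (verts T2)) h2 \<le> card P"
  shows "(\<exists>f. rooted_drawing (\<lambda>e. col e) u T1 r1 f P) \<or>
    (\<exists>g. rooted_drawing (\<lambda>e. \<not> col e) (- u) T2 r2 g P)"
  using assms
proof (induction "h1 + h2" arbitrary: T1 r1 h1 T2 r2 h2 P rule: less_induct)
  case less
  note T1 = less.prems(1-3) and T2 = less.prems(4-6)
  note gp = less.prems(7) and inj = less.prems(8) and card_P = less.prems(9)
  have simple: "simple_graph T1" "simple_graph T2" using T1(1) T2(1) by (auto simp: is_tree_def)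
  have finP: "finite P" using gp by (simp add: general_position_def)
  have n: "1 \<le> card (verts T1)" "1 \<le> card (verts T2)"
    using card_verts_branches[OF T1(1,2)] card_verts_branches[OF T2(1,2)] by auto
  have "P \<noteq> {}" using drawing_bound_pos[OF n, of h1 h2] card_P by auto
  then obtain p0 where p0: "p0 \<in> P" by blast
  show ?case
  proof (cases "children T1 r1 = {} \<or> children T2 r2 = {}")
    case True
    then show ?thesis using draw_childless T1 T2 p0 by metis
  next
    case False
    then obtain k1 k2 where h: "h1 = Suc k1" "h2 = Suc k2"
      using depth_le_0_childless T1 T2 by (metis not0_implies_Suc)
    let ?C = "children T1 r1" and ?D = "children T2 r2"
    define m where "m c = drawing_bound (card (verts (branch T1 r1 c))) k1 (card (verts T2)) h2" for c
    define l where "l d = drawing_bound (card (verts T1)) h1 (card (verts (branch T2 r2 d))) k2" for d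
    define a where "a = (\<Sum>c\<in>?C. m c)"
    define b where "b = (\<Sum>d\<in>?D. l d)"
    have "2 * (a + b) \<le> drawing_bound (card (verts T1)) h1 (card (verts T2)) h2 + 2"
      unfolding a_def b_def m_def l_def h
      by (rule drawing_bound_step[OF card_branch_pos[OF T1(1)]
            card_verts_branches[OF T1(1,2)] finite_children[OF simple(1)] _
            card_branch_pos[OF T2(1)] card_verts_branches[OF T2(1,2)]
            finite_children[OF simple(2)]]) (use False in auto)
    with card_P have ab: "2 * (a + b) \<le> card P + 2" by linarith
    have "1 \<le> m c" if "c \<in> ?C" for c
      unfolding m_def using drawing_bound_pos[OF card_branch_pos[OF T1(1) that] n(2)] .
    then have a: "1 \<le> a"
      unfolding a_def using False sum_pos[OF finite_children[OF simple(1)], of r1 m]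
      by (simp add: Suc_le_eq)
    have "1 \<le> l d" if "d \<in> ?D" for d
      unfolding l_def using drawing_bound_pos[OF n(1) card_branch_pos[OF T2(1) that]] .
    then have b: "1 \<le> b"
      unfolding b_def using False sum_pos[OF finite_children[OF simple(2)], of r2 l]
      by (simp add: Suc_le_eq)
    consider
      (red) p where "p \<in> P" "a \<le> card {q \<in> P. u \<bullet> p < u \<bullet> q \<and> col {p, q}}"
      | (blue) p where "p \<in> P" "b \<le> card {q \<in> P. - u \<bullet> p < - u \<bullet> q \<and> \<not> col {p, q}}"
      using ex_large_degree[OF finP inj a b ab \<open>P \<noteq> {}\<close>, of col] by (elim disjE bexE)
    then show ?thesis
    proof cases
      case red
      show ?thesis
      proof (rule disjCI)
        assume no_blue: "\<nexists>g. rooted_drawing (\<lambda>e. \<not> col e) (- u) T2 r2 g P"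
        show "\<exists>f. rooted_drawing (\<lambda>e. col e) u T1 r1 f P"
        proof (rule join_branches[OF T1(1,2) gp red(1) refl red(2)[unfolded a_def]])
          fix c Y assume c: "c \<in> ?C" and Y: "Y \<subseteq> {q \<in> P. u \<bullet> p < u \<bullet> q \<and> col {p, q}}" "card Y = m c"
          have "Y \<subseteq> P" using Y(1) by blast
          have gpY: "general_position Y"
            using gp \<open>Y \<subseteq> P\<close> unfolding general_position_def by (meson finite_subset subsetD)
          have "(\<exists>f. rooted_drawing (\<lambda>e. col e) u (branch T1 r1 c) c f Y) \<or>
              (\<exists>g. rooted_drawing (\<lambda>e. \<not> col e) (- u) T2 r2 g Y)"
            by (rule less.hyps[of k1 h2, OF _ is_tree_branch[OF T1(1) c] child_in_branch
                  depth_le_branch[OF T1(1) c] T2 gpY inj_on_subset[OF inj \<open>Y \<subseteq> P\<close>]])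
              (use T1(3) h Y(2) m_def in auto)
          then show "\<exists>f. rooted_drawing (\<lambda>e. col e) u (branch T1 r1 c) c f Y"
            using no_blue rooted_drawing_mono[OF _ \<open>Y \<subseteq> P\<close>] by metis
        qed
      qed
    next
      case blue
      show ?thesis
      proof (rule disj_imp[THEN iffD2, OF impI])
        assume no_red: "\<nexists>f. rooted_drawing (\<lambda>e. col e) u T1 r1 f P"
        show "\<exists>g. rooted_drawing (\<lambda>e. \<not> col e) (- u) T2 r2 g P"
        proof (rule join_branches[OF T2(1,2) gp blue(1) refl blue(2)[unfolded b_def]])
          fix d Y assume d: "d \<in> ?D"
            and Y: "Y \<subseteq> {q \<in> P. - u \<bullet> p < - u \<bullet> q \<and> \<not> col {p, q}}" "card Y = l d"
          have "Y \<subseteq> P" using Y(1) by blast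
          have gpY: "general_position Y"
            using gp \<open>Y \<subseteq> P\<close> unfolding general_position_def by (meson finite_subset subsetD)
          have "(\<exists>f. rooted_drawing (\<lambda>e. col e) u T1 r1 f Y) \<or>
              (\<exists>g. rooted_drawing (\<lambda>e. \<not> col e) (- u) (branch T2 r2 d) d g Y)"
            by (rule less.hyps[of h1 k2, OF _ T1 is_tree_branch[OF T2(1) d] child_in_branch
                  depth_le_branch[OF T2(1) d] gpY inj_on_subset[OF inj \<open>Y \<subseteq> P\<close>]])
              (use T2(3) h Y(2) l_def in auto)
          then show "\<exists>g. rooted_drawing (\<lambda>e. \<not> col e) (- u) (branch T2 r2 d) d g Y"
            using no_red rooted_drawing_mono[OF _ \<open>Y \<subseteq> P\<close>] by metis
        qed
      qed
    qed
  qed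
qed

section \<open>The geometric Ramsey number of a tree\<close>

lemma drawing_imp_subgraph:
  assumes simple: "simple_graph T" and draw: "rooted_drawing E u T r f P"
    and mono: "\<And>e. E e \<Longrightarrow> col e = c"
  shows "\<exists>H. subgraph H (complete_geometric_graph P) \<and> monochromatic col H \<and>
    non_crossing H \<and> isomorphic T H"
proof -
  define H where "H = \<lparr>verts = f ` verts T, edges = (\<lambda>e. f ` e) ` edges T\<rparr>"
  have inj: "inj_on f (verts T)" and im: "f ` verts T \<subseteq> P"
    using draw by (auto simp: rooted_drawing_def)
  have edge: "\<exists>x\<in>f ` verts T. \<exists>y\<in>f ` verts T. x \<noteq> y \<and> f ` e = {x, y}" if "e \<in> edges T" for e
  proof -
    have "\<forall>e\<in>edges T. \<exists>v\<in>verts T. \<exists>w\<in>verts T. v \<noteq> w \<and> e = {v, w}"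
      using simple by (simp add: simple_graph_def)
    from bspec[OF this that] obtain v w
      where vw: "v \<in> verts T" "w \<in> verts T" "v \<noteq> w" "e = {v, w}"
      by (elim bexE conjE)
    then have "f v \<noteq> f w" using inj by (simp add: inj_on_eq_iff)
    with vw show ?thesis by (intro bexI[of _ "f v"] bexI[of _ "f w"]) simp_all
  qed
  have "simple_graph H"
    using simple edge by (simp add: simple_graph_def H_def)
  moreover have "edges H \<subseteq> edges (complete_geometric_graph P)"
  proof
    fix e' assume "e' \<in> edges H"
    then obtain e where "e \<in> edges T" "e' = f ` e" by (auto simp: H_def)
    with edge[of e] im show "e' \<in> edges (complete_geometric_graph P)"
      by (simp add: complete_geometric_graph_def) blast
  qed
  ultimately have "subgraph H (complete_geometric_graph P)"
    using im by (simp add: subgraph_def complete_geometric_graph_def H_def)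
  moreover have "monochromatic col H"
    using draw mono by (auto simp: monochromatic_def H_def rooted_drawing_def)
  moreover have "non_crossing H"
    using draw by (auto simp: non_crossing_def H_def rooted_drawing_def)
  moreover have "isomorphic T H"
    unfolding isomorphic_def
  proof (intro exI[of _ f] conjI ballI)
    show "bij_betw f (verts T) (verts H)" using inj by (simp add: bij_betw_def H_def)
    fix v w assume vw: "v \<in> verts T" "w \<in> verts T"
    show "{v, w} \<in> edges T \<longleftrightarrow> {f v, f w} \<in> edges H"
    proof
      assume "{f v, f w} \<in> edges H"
      then obtain e where e: "e \<in> edges T" "f ` {v, w} = f ` e" by (auto simp: H_def)
      have "e \<subseteq> verts T" using e(1) simple by (auto simp: simple_graph_def)
      with e(2) vw have "{v, w} = e" using inj_on_image_eq_iff[OF inj, of "{v, w}" e] by simp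
      with e(1) show "{v, w} \<in> edges T" by simp
    qed (auto simp: H_def intro: image_eqI[where x = "{v, w}"])
  qed
  ultimately show ?thesis by blast
qed

text \<open>With \<open>h = \<lceil>d/2\<rceil>\<close> the bound is \<open>n\<^sup>2 4\<^bsup>2h-2\<^esup>\<close> for \<open>h \<ge> 1\<close>. For \<open>h \<ge> 2\<close>, a longest path already has
at least four vertices, so \<open>4 \<le> n\<close> and the bound is at most \<open>n\<^bsup>2h\<^esup> \<le> n\<^bsup>d+1\<^esup>\<close>.\<close>

lemma drawing_bound_le_power:
  assumes "is_tree T"
  defines "n \<equiv> card (verts T)" and "h \<equiv> Suc (tree_diameter T) div 2"
  shows "drawing_bound n h n h \<le> n ^ (tree_diameter T + 1)"
proof -
  define d where "d = tree_diameter T"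
  have d: "2 * h \<le> d + 1" by (simp add: h_def d_def)
  have nd: "Suc d \<le> n"
  proof -
    obtain xs where "graph_path T xs" "length xs = Suc d"
      using tree_diameter_path(2)[OF assms(1)] by (auto simp: d_def)
    then show ?thesis using length_path_le_card[of T xs] assms(1) by (simp add: is_tree_def n_def)
  qed
  consider "h = 0" | "h = 1" | "2 \<le> h" by linarith
  then have "drawing_bound n h n h \<le> n ^ (d + 1)"
  proof cases
    case 1
    then show ?thesis using nd by (simp add: drawing_bound_def)
  next
    case 2
    then have "n\<^sup>2 \<le> n ^ (d + 1)" using d nd by (intro power_increasing) auto
    with 2 show ?thesis by (simp add: drawing_bound_def power2_eq_square)
  next
    case 3
    have "4 \<le> n" using 3 d nd by linarith
    have "drawing_bound n h n h = n\<^sup>2 * 4 ^ (2 * h - 2)"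
      using 3 by (simp add: drawing_bound_def power2_eq_square mult_2)
    also have "\<dots> \<le> n\<^sup>2 * n ^ (2 * h - 2)"
      using \<open>4 \<le> n\<close> by (intro mult_le_mono2 power_mono) auto
    also have "\<dots> = n ^ (2 + (2 * h - 2))" by (rule power_add[symmetric])
    also have "\<dots> = n ^ (2 * h)"
      using le_add_diff_inverse[of 2 "2 * h"] 3 by simp
    also have "\<dots> \<le> n ^ (d + 1)" using d nd by (intro power_increasing) auto
    finally show ?thesis .
  qed
  then show ?thesis by (simp add: d_def)
qed

theorem theorem10:
  fixes T :: "'a sgraph" and n :: nat
  assumes "n \<ge> 1"
    and "is_tree T"
    and "card (verts T) = n"
  shows "geometric_ramsey T \<le> enat (n ^ (tree_diameter T + 1))"
proof -
  let ?h = "Suc (tree_diameter T) div 2"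
  have simple: "simple_graph T" using assms(2) by (simp add: is_tree_def)
  obtain r where r: "r \<in> verts T" "depth_le T r ?h"
    using tree_has_centre[OF assms(2)] by blast
  have "geometric_ramsey_prop T (n ^ (tree_diameter T + 1))"
    unfolding geometric_ramsey_prop_def
  proof (intro allI impI)
    fix P :: "(real^2) set" and col
    assume P: "general_position P \<and> card P = n ^ (tree_diameter T + 1)"
    then obtain u where u: "inj_on (\<lambda>x. u \<bullet> x) P"
      using ex_injective_direction[of P] by (auto simp: general_position_def)
    have "drawing_bound (card (verts T)) ?h (card (verts T)) ?h \<le> card P"
      using drawing_bound_le_power[OF assms(2)] assms(3) P by simp
    then consider f where "rooted_drawing (\<lambda>e. col e) u T r f P"
      | f where "rooted_drawing (\<lambda>e. \<not> col e) (- u) T r f P"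
      using red_or_blue_drawing[OF assms(2) r assms(2) r _ u, of col] P by blast
    then show "\<exists>H. subgraph H (complete_geometric_graph P) \<and> monochromatic col H \<and>
        non_crossing H \<and> isomorphic T H"
    proof cases
      case 1
      show ?thesis by (rule drawing_imp_subgraph[OF simple 1, where c = True]) simp
    next
      case 2
      show ?thesis by (rule drawing_imp_subgraph[OF simple 2, where c = False]) simp
    qed
  qed
  then show ?thesis
    unfolding geometric_ramsey_def by (intro Inf_lower) blast
qed


end
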